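(* Assume that the continuum hypothesis is true. Let $1\le p<\infty$ and let $X=\mathbf{R}^n$, $n\ge2$, be equipped with a measure $d\mu=w\,dx$ such that $0<w\in L^1_{\rm loc}(\mathbf{R}^n)$. Then there is a nonmeasurable dense $p$-path negligible set $S\subset\mathbf{R}^n$. In particular, $S$ is a nonmeasurable dense $p$-path almost open set.
   Context: Curves are nonconstant, compact (defined on compact intervals), rectifiable and parameterized by arc length, $\gamma:[0,l_\gamma]\to\mathbf{R}^n$. The $p$-modulus of a curve family $\Gamma$ is $\inf_\rho\int\rho^p\,d\mu$ over all Borel $\rho\ge0$ with $\int_\gamma\rho\,ds\ge1$ for all $\gamma\in\Gamma$; a property holds for $p$-almost every curve if it fails only for a family of zero $p$-modulus. $N\subset X$ is $p$-path negligible if $\mathcal L^1(\gamma^{-1}(N))=0$ for $p$-almost every arc-length parameterized curve $\gamma$, where $\mathcal L^1$ is 1-dimensional Lebesgue measure. $U\subset X$ is $p$-path almost open if for $p$-almost every curve $\gamma:[0,l_\gamma]\to X$, $\gamma^{-1}(U)$ is the union of a relatively open set and a set of zero $\mathcal L^1$-measure. Measurability is with respect to the (completed) measure $\mu$, which has the same measurable sets as the Lebesgue measure on $\mathbf{R}^n$. *)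

theory Defs
  imports "HOL-Analysis.Analysis" "HOL-Library.Equipollence"
begin

definition continuum_hypothesis :: bool where
  "continuum_hypothesis \<longleftrightarrow>
     (\<forall>A :: real set. uncountable A \<longrightarrow> A \<approx> (UNIV :: real set))"

definition locally_integrable :: "('a::euclidean_space \<Rightarrow> real) \<Rightarrow> bool" where
  "locally_integrable w \<longleftrightarrow> (\<forall>K. compact K \<longrightarrow> set_integrable lebesgue K w)"

(* The measure w dx, taken on the Lebesgue sigma-algebra. When w > 0 a.e. it has the same null
   sets as Lebesgue measure, so it is already complete. *)
definition weighted_measure :: "('a::euclidean_space \<Rightarrow> real) \<Rightarrow> 'a measure" where
  "weighted_measure w = density lebesgue (\<lambda>x. ennreal (w x))"

lemma sets_weighted_measure [simp]: "sets (weighted_measure w) = sets lebesgue"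
  by (simp add: weighted_measure_def)

definition curve_length :: "(real \<Rightarrow> 'a::metric_space) \<Rightarrow> real \<Rightarrow> real \<Rightarrow> ennreal" where
  "curve_length \<gamma> a b =
     (SUP (k, t) \<in> {(k :: nat, t :: nat \<Rightarrow> real).
                      t 0 = a \<and> t k = b \<and> (\<forall>i<k. t i \<le> t (Suc i))}.
        \<Sum>i<k. ennreal (dist (\<gamma> (t i)) (\<gamma> (t (Suc i)))))"

(* A curve is a pair of a function and the length l of its parameter interval [0, l]; values of
   the function outside [0, l] are irrelevant. Nonconstancy is 0 < l, and rectifiability is
   part of the arc length condition, which makes the length of the curve the real number l. *)
type_synonym 'a curve = "(real \<Rightarrow> 'a) \<times> real"

definition is_curve :: "'a::metric_space curve \<Rightarrow> bool" where
  "is_curve = (\<lambda>(\<gamma>, l). 0 < l \<and> continuous_on {0..l} \<gamma> \<and>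
     (\<forall>t\<in>{0..l}. curve_length \<gamma> 0 t = ennreal t))"

definition curve_preimage :: "'a curve \<Rightarrow> 'a set \<Rightarrow> real set" where
  "curve_preimage = (\<lambda>(\<gamma>, l) A. {t \<in> {0..l}. \<gamma> t \<in> A})"

definition curve_integral :: "('a \<Rightarrow> ennreal) \<Rightarrow> 'a curve \<Rightarrow> ennreal" where
  "curve_integral \<rho> = (\<lambda>(\<gamma>, l). \<integral>\<^sup>+t\<in>{0..l}. \<rho> (\<gamma> t) \<partial>lborel)"

(* Intended for exponents p > 0. *)
definition ennreal_powr :: "ennreal \<Rightarrow> real \<Rightarrow> ennreal" where
  "ennreal_powr x p = (if x = top then top else ennreal (enn2real x powr p))"

(* Admissible functions may take the value infinity. *)
definition p_modulus :: "real \<Rightarrow> 'a::metric_space measure \<Rightarrow> 'a curve set \<Rightarrow> ennreal" where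
  "p_modulus p \<mu> \<Gamma> =
     (INF \<rho> \<in> {\<rho> \<in> borel_measurable borel. \<forall>c\<in>\<Gamma>. 1 \<le> curve_integral \<rho> c}.
        \<integral>\<^sup>+x. ennreal_powr (\<rho> x) p \<partial>\<mu>)"

definition almost_every_curve ::
  "real \<Rightarrow> 'a::metric_space measure \<Rightarrow> ('a curve \<Rightarrow> bool) \<Rightarrow> bool" where
  "almost_every_curve p \<mu> P \<longleftrightarrow> p_modulus p \<mu> {c. is_curve c \<and> \<not> P c} = 0"

definition path_negligible :: "real \<Rightarrow> 'a::metric_space measure \<Rightarrow> 'a set \<Rightarrow> bool" where
  "path_negligible p \<mu> N \<longleftrightarrow>
     almost_every_curve p \<mu> (\<lambda>c. curve_preimage c N \<in> null_sets lebesgue)"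

definition path_almost_open :: "real \<Rightarrow> 'a::metric_space measure \<Rightarrow> 'a set \<Rightarrow> bool" where
  "path_almost_open p \<mu> U \<longleftrightarrow>
     almost_every_curve p \<mu> (\<lambda>c. \<exists>G Z. openin (top_of_set {0..snd c}) G \<and>
       Z \<in> null_sets lebesgue \<and> curve_preimage c U = G \<union> Z)"

end

theory Submission
  imports Defs
begin

text \<open>
  The set is a Sierpinski set: a set that is not Lebesgue null although it meets every null set in
  a countable set. Under the continuum hypothesis the reals carry a well-order with countable
  initial segments, and every null set lies in one of continuum many null \<open>G\<^sub>\<delta>\<close> sets. Choosing for each
  index a point outside the countably many of these sets that come earlier gives a Sierpinski set
  (\<open>sierpinski_set_exists\<close>). Adding a countable dense set makes it dense and keeps both properties.

  Such a set has a null preimage under \<^emph>\<open>every\<close> curve parameterized by arc length, so that the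
  exceptional curve family is empty and has modulus zero. Indeed such a curve is 1-Lipschitz, so its
  image is null in dimension at least 2 (\<open>curve_image_negligible\<close>) and contains only countably many
  points of the set; and the curve spends no time at any single point, because time spent there
  would not contribute to its length (\<open>curve_fibre_null\<close>).

  The set cannot be measurable. It meets every line in a countable set, since lines are null in
  dimension at least 2, and by Tonelli a measurable set with this property is null
  (\<open>negligible_countable_on_lines\<close>).
\<close>

section \<open>A Sierpinski set under the continuum hypothesis\<close>

text \<open>
  The witness is a well-order of minimal order type. Its proper initial segments have smaller
  cardinality than the reals, which under the continuum hypothesis means that they are countable.
\<close>

lemma continuum_hypothesis_order:
  assumes "continuum_hypothesis"
  obtains r :: "real rel"
  where "\<And>a. countable {b. (b, a) \<in> r}" and "\<And>a b. (a, b) \<in> r \<or> (b, a) \<in> r"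
proof -
  define r where "r = card_of (UNIV :: real set)"
  have cr: "Card_order r" and field: "Field r = UNIV"
    unfolding r_def by (rule card_of_Card_order, rule Field_card_of)
  have wo: "wo_rel r"
    unfolding wo_rel_def r_def by (rule card_of_Well_order)
  have initial: "countable {b. (b, a) \<in> r}" for a
  proof -
    have less: "ordLess2 (card_of (underS r a)) (card_of (UNIV :: real set))"
      using card_of_underS[OF cr, of a] field by (simp only: r_def UNIV_I)
    have "countable (underS r a)"
    proof (rule ccontr)
      assume "uncountable (underS r a)"
      then have "underS r a \<approx> (UNIV :: real set)"
        using assms by (auto simp: continuum_hypothesis_def)
      then show False
        using less not_ordLess_ordIso unfolding eqpoll_iff_card_of_ordIso by blast
    qed
    moreover have "{b. (b, a) \<in> r} \<subseteq> insert a (underS r a)"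
      by (auto simp: underS_def)
    ultimately show ?thesis
      by (meson countable_insert countable_subset)
  qed
  have total: "(a, b) \<in> r \<or> (b, a) \<in> r" for a b
    using wo_rel.TOTALS[OF wo] field by blast
  show ?thesis
    using that initial total by blast
qed

text \<open>
  A null set is contained in a null \<open>G\<^sub>\<delta>\<close> set. The latter is coded by a set of pairs \<open>(k, i)\<close>, recording
  which members \<open>i\<close> of a countable basis are contained in the \<open>k\<close>-th of the open sets that it is
  the intersection of, and there are as many sets of natural numbers as there are reals.
\<close>

lemma negligible_cofinal_family:
  obtains N :: "real \<Rightarrow> 'a::euclidean_space set"
  where "\<And>a. negligible (N a)" and "\<And>M. negligible M \<Longrightarrow> \<exists>a. M \<subseteq> N a"
proof -
  obtain \<B> :: "'a set set" where \<B>: "countable \<B>" "topological_basis \<B>"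
    using ex_countable_basis by blast
  define B where "B = from_nat_into \<B>"
  define G where "G c = (\<Inter>k. \<Union>i\<in>{i. prod_encode (k, i) \<in> c}. B i)" for c :: "nat set"
  obtain h :: "real \<Rightarrow> nat set" where h: "bij h"
    using nat_sets_eqpoll_reals eqpoll_sym unfolding eqpoll_def by blast
  \<comment> \<open>Codes of sets that are not null are sent to the empty set.\<close>
  define N where "N a = (if negligible (G (h a)) then G (h a) else {})" for a
  have "\<exists>a. M \<subseteq> N a" if M: "negligible M" for M
  proof -
    have "\<exists>U. open U \<and> M \<subseteq> U \<and> emeasure lebesgue U \<le> ennreal (1 / Suc k)" for k :: nat
    proof -
      have Mn: "M \<in> null_sets lebesgue"
        using M negligible_iff_null_sets by blast
      obtain U where U: "open U" "M \<subseteq> U" "emeasure lebesgue (U - M) < ennreal (1 / Suc k)"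
      proof (rule sets_lebesgue_outer_open)
        show "M \<in> sets lebesgue" "0 < 1 / real (Suc k)"
          using Mn by auto
      qed
      moreover have "emeasure lebesgue (U - M) = emeasure lebesgue U"
        using U(1) Mn by (intro emeasure_Diff_null_set) auto
      ultimately have "emeasure lebesgue U \<le> ennreal (1 / Suc k)"
        by simp
      then show ?thesis
        using U(1,2) by blast
    qed
    then obtain U where U: "\<And>k. open (U k)" "\<And>k. M \<subseteq> U k"
      "\<And>k. emeasure lebesgue (U k) \<le> ennreal (1 / Suc k)"
      by metis
    define c where "c = {n. case prod_decode n of (k, i) \<Rightarrow> i \<in> {i. B i \<subseteq> U k}}"
    have U_eq: "(\<Union>i\<in>{i. prod_encode (k, i) \<in> c}. B i) = U k" for k
    proof
      show "U k \<subseteq> (\<Union>i\<in>{i. prod_encode (k, i) \<in> c}. B i)"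
      proof
        fix x assume "x \<in> U k"
        then obtain V where V: "V \<in> \<B>" "x \<in> V" "V \<subseteq> U k"
          using topological_basisE[OF \<B>(2) U(1)] by metis
        then obtain i where "B i = V"
          using from_nat_into_surj[OF \<B>(1)] unfolding B_def by blast
        then show "x \<in> (\<Union>i\<in>{i. prod_encode (k, i) \<in> c}. B i)"
          using V by (auto simp: c_def)
      qed
    qed (auto simp: c_def)
    then have G: "G c = (\<Inter>k. U k)"
      by (simp add: G_def)
    have "emeasure lebesgue (G c) \<le> 0 + ennreal e" if "0 < e" for e
    proof -
      obtain k where "1 / Suc k < e"
        using \<open>0 < e\<close> nat_approx_posE by blast
      have "emeasure lebesgue (G c) \<le> emeasure lebesgue (U k)"
        unfolding G using U(1) by (intro emeasure_mono) auto
      also have "\<dots> \<le> ennreal (1 / Suc k)"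
        by (rule U(3))
      also have "\<dots> \<le> ennreal e"
        using \<open>1 / Suc k < e\<close> by (intro ennreal_leI) simp
      finally show ?thesis
        by simp
    qed
    then have "emeasure lebesgue (G c) = 0"
      using ennreal_le_epsilon[of 0 "emeasure lebesgue (G c)"] by auto
    moreover have "G c \<in> sets lebesgue"
      unfolding G using U(1) by auto
    ultimately have "negligible (G c)"
      by (simp add: negligible_iff_null_sets null_sets_def)
    moreover obtain a where "h a = c"
      using h by (metis bij_pointE)
    ultimately have "N a = G c"
      by (simp add: N_def)
    then show ?thesis
      using G U(2) by blast
  qed
  moreover have "negligible (N a)" for a
    by (simp add: N_def)
  ultimately show ?thesis
    using that by blast
qed

text \<open>
  The point \<open>x a\<close> avoids \<open>N b\<close> for all \<open>b\<close> up to and including \<open>a\<close>. So \<open>N b\<close> can only contain points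
  whose index precedes \<open>b\<close>, and these are countably many. The range of \<open>x\<close> is not null, for
  otherwise it would be contained in some \<open>N b\<close>, which \<open>x b\<close> avoids. There is no recursion: the choice
  of \<open>x a\<close> does not depend on the earlier points.
\<close>

lemma sierpinski_set_exists:
  assumes "continuum_hypothesis"
  obtains S :: "'a::euclidean_space set"
  where "\<not> negligible S" and "\<And>M. negligible M \<Longrightarrow> countable (S \<inter> M)"
proof -
  obtain r :: "real rel" where r: "\<And>a. countable {b. (b, a) \<in> r}" "\<And>a b. (a, b) \<in> r \<or> (b, a) \<in> r"
    using continuum_hypothesis_order[OF assms] by metis
  obtain N :: "real \<Rightarrow> 'a set" where N: "\<And>a. negligible (N a)" "\<And>M. negligible M \<Longrightarrow> \<exists>a. M \<subseteq> N a"
    using negligible_cofinal_family by metis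
  have "\<exists>y. y \<notin> (\<Union>b\<in>{b. (b, a) \<in> r}. N b)" for a
  proof -
    have "negligible (\<Union>b\<in>{b. (b, a) \<in> r}. N b)"
      using r(1) N(1) by (intro negligible_countable_Union) auto
    then show ?thesis
      using non_negligible_UNIV by (metis UNIV_eq_I)
  qed
  then obtain x where x: "\<And>a b. (b, a) \<in> r \<Longrightarrow> x a \<notin> N b"
    by (metis (mono_tags, lifting) UN_I mem_Collect_eq)
  have "countable (range x \<inter> M)" if M: "negligible M" for M
  proof -
    obtain b where b: "M \<subseteq> N b"
      using N(2) M by blast
    have "range x \<inter> M \<subseteq> x ` {a. (a, b) \<in> r}"
      using b r(2) x by blast
    then show ?thesis
      using r(1) by (meson countable_image countable_subset)
  qed
  moreover have "\<not> negligible (range x)"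
    using N(2) r(2) x by (metis rangeI subsetD)
  ultimately show ?thesis
    using that by blast
qed

section \<open>Nonmeasurability\<close>

text \<open>
  Translation invariance replaces coordinates adapted to \<open>v\<close>: integrating the indicator of \<open>S\<close> at
  \<open>x + t v\<close> over \<open>x\<close> first and then over \<open>t\<close> in the unit interval gives the measure of \<open>S\<close>, while
  integrating over \<open>t\<close> first gives 0.
\<close>

lemma negligible_countable_on_lines:
  fixes S :: "'a::euclidean_space set" and v :: 'a
  assumes "S \<in> sets lebesgue" and lines: "\<And>x. countable {t. x + t *\<^sub>R v \<in> S}"
  shows "negligible S"
proof -
  \<comment> \<open>Tonelli is applied to a Borel subset of full measure.\<close>
  obtain B Z Z' where B: "S = B \<union> Z" "Z \<subseteq> Z'" "Z' \<in> null_sets lborel" "B \<in> sets lborel"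
    using assms(1) by (rule sets_completionE)
  have [measurable]: "B \<in> sets borel"
    using B(4) by simp
  define f :: "real \<times> 'a \<Rightarrow> ennreal"
    where "f = (\<lambda>(t, x). indicator {0..1} t * indicator B (x + t *\<^sub>R v))"
  have f [measurable]: "f \<in> borel_measurable (lborel \<Otimes>\<^sub>M lborel)"
    unfolding f_def by measurable
  have inner_space: "(\<integral>\<^sup>+ x. f (t, x) \<partial>lborel) = indicator {0..1} t * emeasure lborel B" for t
  proof -
    have "(\<integral>\<^sup>+ x. f (t, x) \<partial>lborel)
        = indicator {0..1} t * (\<integral>\<^sup>+ x. indicator B (t *\<^sub>R v + x) \<partial>lborel)"
      unfolding f_def by (simp add: nn_integral_cmult add.commute)
    also have "(\<integral>\<^sup>+ x. indicator B (t *\<^sub>R v + x) \<partial>lborel)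
        = (\<integral>\<^sup>+ x. indicator B x \<partial>distr lborel borel ((+) (t *\<^sub>R v)))"
      by (subst nn_integral_distr) auto
    also have "\<dots> = emeasure lborel B"
      by (simp add: lborel_distr_plus)
    finally show ?thesis .
  qed
  have inner_line: "(\<integral>\<^sup>+ t. f (t, x) \<partial>lborel) = 0" for x
  proof -
    have "countable {t. x + t *\<^sub>R v \<in> B}"
      by (rule countable_subset[OF _ lines[of x]]) (use B in auto)
    then have "emeasure lborel {t. x + t *\<^sub>R v \<in> B} = 0" "{t. x + t *\<^sub>R v \<in> B} \<in> sets lborel"
      by (simp_all add: emeasure_lborel_countable sets.countable)
    then have "AE t in lborel. t \<notin> {t. x + t *\<^sub>R v \<in> B}"
      by (intro AE_not_in) (auto simp: null_sets_def)
    then have "AE t in lborel. f (t, x) = 0"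
      by (elim eventually_mono) (simp add: f_def)
    then have "(\<integral>\<^sup>+ t. f (t, x) \<partial>lborel) = (\<integral>\<^sup>+ t. 0 \<partial>(lborel :: real measure))"
      by (rule nn_integral_cong_AE)
    then show ?thesis
      by simp
  qed
  have "emeasure lborel B = (\<integral>\<^sup>+ t. indicator {0..1::real} t * emeasure lborel B \<partial>lborel)"
    by (subst nn_integral_multc) auto
  also have "\<dots> = (\<integral>\<^sup>+ t. (\<integral>\<^sup>+ x. f (t, x) \<partial>lborel) \<partial>lborel)"
    by (simp add: inner_space)
  also have "\<dots> = (\<integral>\<^sup>+ x. (\<integral>\<^sup>+ t. f (t, x) \<partial>lborel) \<partial>lborel)"
    by (rule lborel_pair.Fubini[symmetric]) (rule f)
  also have "\<dots> = 0"
    by (simp add: inner_line)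
  finally have "B \<union> Z' \<in> null_sets lborel"
    using B(3,4) by (intro null_sets.Un) (auto simp: null_sets_def)
  then have "negligible (B \<union> Z')"
    by (simp add: negligible_iff_null_sets null_sets_completionI)
  then show ?thesis
    using B(1,2) negligible_subset by blast
qed

lemma negligible_if_countable_on_negligible:
  fixes S :: "'a::euclidean_space set"
  assumes "2 \<le> DIM('a)" "S \<in> sets lebesgue"
    and countable: "\<And>M. negligible M \<Longrightarrow> countable (S \<inter> M)"
  shows "negligible S"
proof -
  obtain v :: 'a where v: "v \<in> Basis"
    using nonempty_Basis by blast
  have "countable {t. x + t *\<^sub>R v \<in> S}" for x
  proof -
    have "dim (span {v}) < DIM('a)"
      using assms(1) dim_le_card[of "span {v}" "{v}"] by simp
    then have "negligible ((+) x ` span {v})"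
      by (intro negligible_translation negligible_lowdim)
    then have "countable (S \<inter> (+) x ` span {v})"
      by (rule countable)
    moreover have "(\<lambda>t. x + t *\<^sub>R v) ` {t. x + t *\<^sub>R v \<in> S} \<subseteq> S \<inter> (+) x ` span {v}"
      by (auto simp: span_singleton)
    moreover have "inj_on (\<lambda>t. x + t *\<^sub>R v) {t. x + t *\<^sub>R v \<in> S}"
      using v by (auto simp: inj_on_def)
    ultimately show ?thesis
      using countable_image_inj_on countable_subset by metis
  qed
  then show ?thesis
    using assms(2) by (rule negligible_countable_on_lines[rotated])
qed

section \<open>Curves parameterized by arc length\<close>

text \<open>
  A partition of the first interval, followed by one more point, is a partition of the larger one.
\<close>

lemma curve_length_extend:
  assumes "a \<le> s" "s \<le> t"
  shows "curve_length \<gamma> a s + ennreal (dist (\<gamma> s) (\<gamma> t)) \<le> curve_length \<gamma> a t"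
proof -
  let ?P = "\<lambda>b. {(k :: nat, \<tau> :: nat \<Rightarrow> real). \<tau> 0 = a \<and> \<tau> k = b \<and> (\<forall>i<k. \<tau> i \<le> \<tau> (Suc i))}"
  let ?f = "\<lambda>(k :: nat, \<tau> :: nat \<Rightarrow> real). \<Sum>i<k. ennreal (dist (\<gamma> (\<tau> i)) (\<gamma> (\<tau> (Suc i))))"
  have "(1, \<lambda>i. if i = 0 then a else s) \<in> ?P s"
    using assms by auto
  then have "?P s \<noteq> {}"
    by blast
  have "curve_length \<gamma> a s + ennreal (dist (\<gamma> s) (\<gamma> t))
      = (SUP q\<in>?P s. ?f q + ennreal (dist (\<gamma> s) (\<gamma> t)))"
    unfolding curve_length_def using \<open>?P s \<noteq> {}\<close> by (subst ennreal_SUP_add_left) auto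
  also have "\<dots> \<le> curve_length \<gamma> a t"
  proof (rule SUP_least)
    fix q assume "q \<in> ?P s"
    then obtain k \<tau> where q: "q = (k, \<tau>)" "\<tau> 0 = a" "\<tau> k = s" "\<forall>i<k. \<tau> i \<le> \<tau> (Suc i)"
      by auto
    let ?\<tau> = "\<lambda>i. if i \<le> k then \<tau> i else t"
    have "(Suc k, ?\<tau>) \<in> ?P t"
      using q assms by (auto simp: less_Suc_eq)
    moreover have "?f q + ennreal (dist (\<gamma> s) (\<gamma> t)) = ?f (Suc k, ?\<tau>)"
      using q by (simp add: sum_nonneg)
    ultimately show "?f q + ennreal (dist (\<gamma> s) (\<gamma> t)) \<le> curve_length \<gamma> a t"
      unfolding curve_length_def by (metis (no_types, lifting) SUP_upper)
  qed
  finally show ?thesis .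
qed

lemma is_curve_Lipschitz:
  assumes "is_curve (\<gamma>, l)" "0 \<le> s" "s \<le> t" "t \<le> l"
  shows "dist (\<gamma> s) (\<gamma> t) \<le> t - s"
proof -
  have "curve_length \<gamma> 0 s = ennreal s" "curve_length \<gamma> 0 t = ennreal t"
    using assms by (auto simp: is_curve_def)
  then have "ennreal (s + dist (\<gamma> s) (\<gamma> t)) \<le> ennreal t"
    using curve_length_extend[of 0 s t \<gamma>] assms by (simp add: ennreal_plus)
  then show ?thesis
    using assms by (subst (asm) ennreal_le_iff) auto
qed

text \<open>
  Let \<open>E\<close> be the set of times spent at \<open>x\<close>. Every chord from time \<open>s\<close> to time \<open>t\<close> is at most as long as the
  time spent outside \<open>E\<close> in between. Without a visit to \<open>x\<close> this is the Lipschitz bound; if \<open>u\<close> and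
  \<open>v\<close> are the times of the first and the last visit, the curve returns to the same point, so only
  the pieces from \<open>s\<close> to \<open>u\<close> and from \<open>v\<close> to \<open>t\<close> count. Summing over a partition, the total length \<open>l\<close> is at most \<open>l\<close> minus the measure of \<open>E\<close>.
\<close>

lemma curve_fibre_null:
  assumes curve: "is_curve (\<gamma>, l)"
  shows "{t \<in> {0..l}. \<gamma> t = x} \<in> null_sets lebesgue"
proof -
  define E where "E = {t \<in> {0..l}. \<gamma> t = x}"
  have l: "0 < l" and cont: "continuous_on {0..l} \<gamma>" and len: "curve_length \<gamma> 0 l = ennreal l"
    using curve by (auto simp: is_curve_def)
  have "closed E"
    unfolding E_def using continuous_closed_preimage_constant[OF cont] by auto
  then have compact: "compact (E \<inter> {s..t})" for s t
    by (intro closed_Int_compact) auto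
  have E [measurable]: "E \<in> sets lebesgue"
    using \<open>closed E\<close> by auto
  define F where "F t = measure lebesgue ({0..t} - E)" for t
  have lm: "{a..b} - E \<in> lmeasurable" for a b
    by (intro fmeasurable_Diff) auto
  have F_diff: "F t - F s \<ge> measure lebesgue A"
    if "0 \<le> s" "s \<le> t" "A \<subseteq> {s<..t} - E" "A \<in> lmeasurable" for s t A
  proof -
    have "measure lebesgue A + measure lebesgue ({0..s} - E)
        = measure lebesgue (A \<union> ({0..s} - E))"
    proof -
      have "A \<inter> ({0..s} - E) = {}"
        using that by auto
      then show ?thesis
        using measure_Un3[OF that(4) lm[of 0 s]] by simp
    qed
    also have "\<dots> \<le> measure lebesgue ({0..t} - E)"
      using that lm by (intro measure_mono_fmeasurable) (auto simp: fmeasurable.Un)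
    finally show ?thesis
      by (simp add: F_def)
  qed
  have chord: "dist (\<gamma> s) (\<gamma> t) \<le> F t - F s" if st: "0 \<le> s" "s \<le> t" "t \<le> l" for s t
  proof (cases "E \<inter> {s..t} = {}")
    case True
    then have "measure lebesgue {s<..<t} \<le> F t - F s"
      using st by (intro F_diff) auto
    then show ?thesis
      using is_curve_Lipschitz[OF curve st] st by simp
  next
    case False
    obtain u where u: "u \<in> E \<inter> {s..t}" "\<And>y. y \<in> E \<inter> {s..t} \<Longrightarrow> u \<le> y"
      using compact_attains_inf[OF compact False] by blast
    obtain v where v: "v \<in> E \<inter> {s..t}" "\<And>y. y \<in> E \<inter> {s..t} \<Longrightarrow> y \<le> v"
      using compact_attains_sup[OF compact False] by blast
    have "measure lebesgue ({s<..<u} \<union> {v<..<t}) = measure lebesgue {s<..<u} + measure lebesgue {v<..<t}"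
    proof -
      have "u \<le> v"
        using u(1) v(2) by blast
      then have "{s<..<u} \<inter> {v<..<t} = {}"
        by auto
      then show ?thesis
        using measure_Un3[of "{s<..<u}" lebesgue "{v<..<t}"] by simp
    qed
    moreover have "measure lebesgue ({s<..<u} \<union> {v<..<t}) \<le> F t - F s"
    proof (rule F_diff)
      show "{s<..<u} \<union> {v<..<t} \<subseteq> {s<..t} - E"
      proof
        fix y assume "y \<in> {s<..<u} \<union> {v<..<t}"
        then show "y \<in> {s<..t} - E"
          using u(1) v(1) u(2)[of y] v(2)[of y] by auto
      qed
    qed (use st in auto)
    moreover have "dist (\<gamma> s) (\<gamma> u) \<le> u - s" "dist (\<gamma> v) (\<gamma> t) \<le> t - v"
      using is_curve_Lipschitz[OF curve] st u v by auto
    moreover have "dist (\<gamma> s) (\<gamma> t) \<le> dist (\<gamma> s) (\<gamma> u) + dist (\<gamma> v) (\<gamma> t)"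
      using u v dist_triangle[of "\<gamma> s" "\<gamma> t" x] by (simp add: E_def)
    ultimately show ?thesis
      using u v by simp
  qed
  have "curve_length \<gamma> 0 l \<le> ennreal (F l)"
    unfolding curve_length_def
  proof (rule SUP_least)
    fix q assume "q \<in> {(k :: nat, \<tau> :: nat \<Rightarrow> real).
      \<tau> 0 = 0 \<and> \<tau> k = l \<and> (\<forall>i<k. \<tau> i \<le> \<tau> (Suc i))}"
    then obtain k \<tau> where q: "q = (k, \<tau>)"
      and \<tau>: "\<tau> 0 = 0" "\<tau> k = l" "\<forall>i<k. \<tau> i \<le> \<tau> (Suc i)"
      by auto
    have mono: "\<tau> i \<le> \<tau> j" if "i \<le> j" "j \<le> k" for i j
      using that
    proof (induction j rule: dec_induct)
      case (step j)
      then show ?case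
        using \<tau>(3) by (metis Suc_le_lessD Suc_leD order_trans)
    qed simp
    have "(\<Sum>i<k. dist (\<gamma> (\<tau> i)) (\<gamma> (\<tau> (Suc i)))) \<le> (\<Sum>i<k. F (\<tau> (Suc i)) - F (\<tau> i))"
    proof (rule sum_mono)
      fix i assume "i \<in> {..<k}"
      then show "dist (\<gamma> (\<tau> i)) (\<gamma> (\<tau> (Suc i))) \<le> F (\<tau> (Suc i)) - F (\<tau> i)"
        using mono[of 0 i] mono[of "Suc i" k] \<tau> by (intro chord) auto
    qed
    also have "\<dots> = F l - F 0"
      using \<tau> sum_lessThan_telescope[of "\<lambda>i. F (\<tau> i)" k] by simp
    also have "\<dots> \<le> F l"
      by (simp add: F_def)
    finally have "ennreal (\<Sum>i<k. dist (\<gamma> (\<tau> i)) (\<gamma> (\<tau> (Suc i)))) \<le> ennreal (F l)"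
      by (rule ennreal_leI)
    then show "(case q of (k, \<tau>) \<Rightarrow> \<Sum>i<k. ennreal (dist (\<gamma> (\<tau> i)) (\<gamma> (\<tau> (Suc i))))) \<le> ennreal (F l)"
      by (simp add: q sum_ennreal)
  qed
  then have "l \<le> F l"
    using len F_def by (simp add: ennreal_le_iff)
  moreover have "F l = l - measure lebesgue E"
    unfolding F_def using l E by (subst measurable_measure_Diff) (auto simp: E_def)
  ultimately have "measure lebesgue E = 0"
    using measure_nonneg[of lebesgue E] by linarith
  moreover have "E \<in> lmeasurable"
    using compact[of 0 l] by (metis E_def Int_absorb2 lmeasurable_compact mem_Collect_eq subsetI)
  ultimately show ?thesis
    unfolding E_def[symmetric] using negligible_iff_measure negligible_iff_null_sets by blast
qed

text \<open>
  The parameter interval, embedded in the plane as a segment, is a null set, and Lipschitz maps that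
  do not lower the dimension of the ambient space preserve null sets.
\<close>

lemma curve_image_negligible:
  fixes \<gamma> :: "real \<Rightarrow> 'a::euclidean_space"
  assumes "2 \<le> DIM('a)" and curve: "is_curve (\<gamma>, l)"
  shows "negligible (\<gamma> ` {0..l})"
proof -
  have Lip: "dist (\<gamma> s) (\<gamma> t) \<le> dist s t" if "s \<in> {0..l}" "t \<in> {0..l}" for s t
    using is_curve_Lipschitz[OF curve, of s t] is_curve_Lipschitz[OF curve, of t s] that
    by (cases "s \<le> t") (auto simp: dist_real_def dist_commute)
  let ?L = "{0..l} \<times> {0::real}"
  have "?L \<subseteq> {z. (0, 1) \<bullet> z = (0::real)}"
    by auto
  moreover have "negligible {z :: real \<times> real. (0, 1) \<bullet> z = 0}"
    by (rule negligible_hyperplane) (auto simp: zero_prod_def)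
  ultimately have "negligible ?L"
    using negligible_subset by blast
  then have "negligible ((\<gamma> \<circ> fst) ` ?L)"
  proof (rule negligible_locally_Lipschitz_image[rotated])
    fix z assume "z \<in> ?L"
    then have "\<forall>y\<in>?L \<inter> UNIV. norm ((\<gamma> \<circ> fst) y - (\<gamma> \<circ> fst) z) \<le> 1 * norm (y - z)"
      using Lip by (auto simp: dist_norm norm_Pair)
    then show "\<exists>T B. open T \<and> z \<in> T \<and>
        (\<forall>y\<in>?L \<inter> T. norm ((\<gamma> \<circ> fst) y - (\<gamma> \<circ> fst) z) \<le> B * norm (y - z))"
      by blast
  qed (use assms(1) in auto)
  moreover have "(\<gamma> \<circ> fst) ` ?L = \<gamma> ` {0..l}"
    by force
  ultimately show ?thesis
    by simp
qed

lemma curve_preimage_null: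
  fixes T :: "'a::euclidean_space set"
  assumes "2 \<le> DIM('a)" and countable: "\<And>M. negligible M \<Longrightarrow> countable (T \<inter> M)"
    and "is_curve c"
  shows "curve_preimage c T \<in> null_sets lebesgue"
proof -
  obtain \<gamma> l where c: "c = (\<gamma>, l)"
    by fastforce
  have "countable (T \<inter> \<gamma> ` {0..l})"
    using assms c by (intro countable curve_image_negligible) auto
  then have "(\<Union>x\<in>T \<inter> \<gamma> ` {0..l}. {t \<in> {0..l}. \<gamma> t = x}) \<in> null_sets lebesgue"
    using curve_fibre_null assms(3) c by (intro null_sets_UN') auto
  moreover have "(\<Union>x\<in>T \<inter> \<gamma> ` {0..l}. {t \<in> {0..l}. \<gamma> t = x}) = curve_preimage c T"
    by (auto simp: c curve_preimage_def)
  ultimately show ?thesis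
    by simp
qed

text \<open>
  The zero function is admissible for the empty curve family.
\<close>

lemma almost_every_curveI:
  assumes "\<And>c. is_curve c \<Longrightarrow> P c"
  shows "almost_every_curve p \<mu> P"
proof -
  have empty: "{c. is_curve c \<and> \<not> P c} = {}"
    using assms by blast
  moreover have "p_modulus p \<mu> {} \<le> (\<integral>\<^sup>+x. ennreal_powr 0 p \<partial>\<mu>)"
    unfolding p_modulus_def by (rule INF_lower2[of "\<lambda>_. 0"]) auto
  ultimately show ?thesis
    unfolding almost_every_curve_def empty by (simp add: ennreal_powr_def)
qed

section \<open>A nonmeasurable dense set\<close>

theorem proposition7p5:
  fixes w :: "real ^ 'n \<Rightarrow> real" and p :: real
  assumes "continuum_hypothesis"
    and "1 \<le> p"
    and "CARD('n) \<ge> 2"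
    and "locally_integrable w"
    and "AE x in lebesgue. 0 < w x"
  shows "\<exists>S :: (real ^ 'n) set.
    S \<notin> sets (weighted_measure w) \<and>
    closure S = UNIV \<and>
    path_negligible p (weighted_measure w) S \<and>
    path_almost_open p (weighted_measure w) S"
proof -
  have dim: "2 \<le> DIM(real ^ 'n)"
    using assms(3) by simp
  obtain S0 :: "(real ^ 'n) set"
    where S0: "\<not> negligible S0" "\<And>M. negligible M \<Longrightarrow> countable (S0 \<inter> M)"
    using sierpinski_set_exists[OF assms(1)] by metis
  obtain D :: "(real ^ 'n) set"
    where D: "countable D" "\<And>X. open X \<Longrightarrow> X \<noteq> {} \<Longrightarrow> \<exists>d\<in>D. d \<in> X"
    using countable_dense_setE by metis
  define S where "S = S0 \<union> D"
  have S: "countable (S \<inter> M)" if "negligible M" for M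
  proof -
    have "S \<inter> M \<subseteq> (S0 \<inter> M) \<union> D"
      by (auto simp: S_def)
    then show ?thesis
      using S0(2)[OF that] D(1) by (meson countable_Un countable_subset)
  qed
  have "\<not> negligible S"
    using S0(1) negligible_subset unfolding S_def by blast
  then have "S \<notin> sets (weighted_measure w)"
    using negligible_if_countable_on_negligible[OF dim _ S] by auto
  moreover have "closure S = UNIV"
  proof -
    have "- closure S = {}"
      using D(2)[of "- closure S"] closure_subset[of S] by (auto simp: S_def)
    then show ?thesis
      by auto
  qed
  moreover have null: "curve_preimage c S \<in> null_sets lebesgue" if "is_curve c" for c
    using curve_preimage_null[OF dim S that] .
  then have "path_negligible p (weighted_measure w) S"
    unfolding path_negligible_def by (rule almost_every_curveI)
  moreover have "path_almost_open p (weighted_measure w) S"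
    unfolding path_almost_open_def
    by (rule almost_every_curveI) (metis null Un_empty_left openin_empty)
  ultimately show ?thesis
    by blast
qed

end
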